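(* Let $G$ be a locally compact abelian group which has an open subgroup $G_0$ with $G_0\cong\mathbf{R}^m\times K$ for some $m\in\mathbf{Z}_+$ and some compact group $K$, and such that $G/G_0\cong\mathbf{Z}^k\times F$ for some $k\in\mathbf{Z}_+$ and some torsion group $F$. Let $X$ be a locally convex topological vector space over $\mathbf{C}$. Then: (a) $P^n(G)$ is finite dimensional for each $n\in\mathbf{Z}_+$. (b) If moreover $F$ is of bounded order, then for each $n\in\mathbf{Z}_+$ and each $p\in P^n(G,X)$ there exist finitely many $p_1,\dots,p_l\in P^n(G,X)$ and $q_1,\dots,q_l\in P^n(G)$ with $q_j(0)=0$ such that $\Delta_h p(t)=\sum_{j=1}^{l}p_j(t)q_j(h)$ for all $h,t\in G$.
   Context: $\mathbf{Z}_+=\{0,1,2,\dots\}$. $\Delta_h p(t)=p(t+h)-p(t)$. A group is torsion if every element has finite order, and of bounded order if the orders of its elements are bounded. For an abelian topological group $S$ and a topological vector space $X$, a continuous $p:S\to X$ is a polynomial of degree at most $n$ if for all $s,t\in S$ the map $m\mapsto p(s+mt)$, $m\in\mathbf{Z}_+$, is a polynomial in $m$ of degree at most $n$ with coefficients in $X$; $P^n(S,X)$ is the space of these and $P^n(S)=P^n(S,\mathbf{C})$. *)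

theory Defs
  imports "HOL-Analysis.Analysis" "HOL-Algebra.Product_Groups" "HOL-Algebra.Elementary_Groups"
begin

definition add_grp :: "'a::ab_group_add monoid" where
  "add_grp = \<lparr>carrier = UNIV, monoid.mult = (+), one = 0\<rparr>"

definition natmul :: "nat \<Rightarrow> 'a::ab_group_add \<Rightarrow> 'a" where
  "natmul m t = (\<Sum>i<m. t)"

definition ab_top_group :: "'a::ab_group_add topology \<Rightarrow> bool" where
  "ab_top_group T \<longleftrightarrow> topspace T = UNIV \<and> Hausdorff_space T \<and>
     continuous_map (prod_topology T T) T (\<lambda>(x, y). x + y) \<and>
     continuous_map T T uminus"

definition complex_vs :: "(complex \<Rightarrow> 'x::ab_group_add \<Rightarrow> 'x) \<Rightarrow> bool" where
  "complex_vs sm \<longleftrightarrow>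
     (\<forall>a x y. sm a (x + y) = sm a x + sm a y) \<and>
     (\<forall>a b x. sm (a + b) x = sm a x + sm b x) \<and>
     (\<forall>a b x. sm (a * b) x = sm a (sm b x)) \<and>
     (\<forall>x. sm 1 x = x)"

definition convex_set_vs :: "(complex \<Rightarrow> 'x::ab_group_add \<Rightarrow> 'x) \<Rightarrow> 'x set \<Rightarrow> bool" where
  "convex_set_vs sm V \<longleftrightarrow> (\<forall>x\<in>V. \<forall>y\<in>V. \<forall>u::real. 0 \<le> u \<and> u \<le> 1 \<longrightarrow>
      sm (complex_of_real u) x + sm (complex_of_real (1 - u)) y \<in> V)"

definition locally_convex_tvs :: "'x::ab_group_add topology \<Rightarrow> (complex \<Rightarrow> 'x \<Rightarrow> 'x) \<Rightarrow> bool" where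
  "locally_convex_tvs T sm \<longleftrightarrow> complex_vs sm \<and> topspace T = UNIV \<and> Hausdorff_space T \<and>
     continuous_map (prod_topology T T) T (\<lambda>(x, y). x + y) \<and>
     continuous_map (prod_topology euclidean T) T (\<lambda>(a, x). sm a x) \<and>
     (\<forall>U. openin T U \<and> 0 \<in> U \<longrightarrow>
        (\<exists>V. openin T V \<and> 0 \<in> V \<and> V \<subseteq> U \<and> convex_set_vs sm V))"

definition poly_space ::
  "'s::ab_group_add topology \<Rightarrow> 'x::ab_group_add topology \<Rightarrow> (complex \<Rightarrow> 'x \<Rightarrow> 'x) \<Rightarrow> nat
     \<Rightarrow> ('s \<Rightarrow> 'x) set" where
  "poly_space TS TX sm n = {p. continuous_map TS TX p \<and>
     (\<forall>s t. \<exists>c::nat \<Rightarrow> 'x. \<forall>m::nat.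
        p (s + natmul m t) = (\<Sum>j\<le>n. sm (of_nat m ^ j) (c j)))}"

abbreviation scalar_poly_space :: "'s::ab_group_add topology \<Rightarrow> nat \<Rightarrow> ('s \<Rightarrow> complex) set" where
  "scalar_poly_space TS n \<equiv> poly_space TS euclidean (*) n"

text \<open>R^m realised as the functions nat \<Rightarrow> real vanishing from index m on.\<close>
definition Rpow :: "nat \<Rightarrow> (nat \<Rightarrow> real) set" where
  "Rpow m = {x. \<forall>i\<ge>m. x i = 0}"

end

theory Submission
  imports Defs "HOL-Computational_Algebra.Polynomial"
begin

text \<open>Lifting a basis of \<open>\<int>^k\<close> and extending the \<open>\<real>^m\<close>-coordinates of \<open>G0\<close> by divisibility gives
  \<open>k + m\<close> continuous additive coordinates on \<open>G\<close>, whose common kernel consists of elements with a nonzero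
  multiple in the compact group \<open>K\<close>. A polynomial in \<open>j \<in> \<nat>\<close> with values in a compact set is constant,
  hence every polynomial on \<open>G\<close> is invariant under that kernel. Along each coordinate line it is given
  by Lagrange interpolation at \<open>0, \<dots>, n\<close> (at rational points because it is polynomial along every
  cyclic subgroup, at real points by continuity), so \<open>p (t + h)\<close> is a sum of monomials in the coordinates
  of \<open>h\<close> whose coefficients are combinations of translates of \<open>p\<close>. This gives (a); comparing powers
  of \<open>j\<close> in \<open>p (t + j h)\<close> removes the monomials of degree above \<open>n\<close> and gives (b).\<close>

section \<open>Multiples in abelian groups\<close>

lemma natmul_0 [simp]: "natmul 0 t = 0"
  and natmul_Suc [simp]: "natmul (Suc m) t = t + natmul m t"
  by (simp_all add: natmul_def add.commute)

lemma natmul_add: "natmul (m + n) t = natmul m t + natmul n t"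
  by (induction m) (simp_all add: add.assoc)

lemma natmul_mult: "natmul (m * n) t = natmul m (natmul n t)"
  by (induction m) (simp_all add: natmul_add)

lemma natmul_add_right: "natmul m (s + t) = natmul m s + natmul m t"
  by (simp add: natmul_def sum.distrib)

lemma natmul_diff_right: "natmul m (s - t) = natmul m s - natmul m t"
  by (simp add: natmul_def sum_subtractf)

lemma natmul_eq_of_nat_mult: "natmul m x = of_nat m * x" for x :: "'a::ring_1"
  by (simp add: natmul_def)

lemma (in additive) natmul: "f (natmul m t) = natmul m (f t)"
  by (simp add: natmul_def sum)

lemma add_grp_simps [simp]:
  "carrier add_grp = UNIV" "x \<otimes>\<^bsub>add_grp\<^esub> y = x + y" "\<one>\<^bsub>add_grp\<^esub> = 0"
  by (simp_all add: add_grp_def)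

lemma comm_group_add_grp: "comm_group add_grp"
proof (rule comm_groupI)
  show "\<exists>y\<in>carrier add_grp. y \<otimes>\<^bsub>add_grp\<^esub> x = \<one>\<^bsub>add_grp\<^esub>" for x :: 'a
    by (auto intro: exI[of _ "- x"])
qed (auto simp: ac_simps)

lemma group_add_grp: "group add_grp"
  using comm_group_add_grp by (rule comm_group.axioms)

lemma inv_add_grp [simp]: "inv\<^bsub>add_grp\<^esub> x = - x"
  using group.inv_equality[OF group_add_grp, of "- x" x] by simp

lemma nat_pow_add_grp: "x [^]\<^bsub>add_grp\<^esub> (m :: nat) = natmul m x"
  by (induction m) (simp_all add: add.commute)

lemma additive_iff_hom_add_grp: "Modules.additive f \<longleftrightarrow> f \<in> hom add_grp add_grp"
  by (simp add: Modules.additive_def hom_def)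

definition intmul :: "int \<Rightarrow> 'a::ab_group_add \<Rightarrow> 'a" where
  "intmul a t = t [^]\<^bsub>add_grp\<^esub> a"

lemma intmul_of_nat: "intmul (int m) t = natmul m t"
  by (simp add: intmul_def int_pow_int nat_pow_add_grp)

lemma intmul_add: "intmul (a + b) t = intmul a t + intmul b t"
  using group.int_pow_mult[OF group_add_grp, of t a b] by (simp add: intmul_def)

lemma intmul_minus: "intmul (- a) t = - intmul a t"
  using group.int_pow_neg[OF group_add_grp, of t a] by (simp add: intmul_def)

lemma intmul_zero [simp]: "intmul 0 t = 0"
  using intmul_of_nat[of 0 t] by simp

lemma intmul_eq_of_int_mult: "intmul a x = of_int a * x" for x :: "'a::ring_1"
  by (cases a rule: int_cases2) (simp_all add: intmul_of_nat intmul_minus natmul_eq_of_nat_mult)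

lemma (in additive) intmul: "f (intmul a t) = intmul a (f t)"
  using hom_int_pow[of f add_grp add_grp t a] additive_axioms
  by (simp add: intmul_def additive_iff_hom_add_grp group_add_grp)

section \<open>Polynomials with coefficients in a vector space\<close>

lemma poly_eq_sum_coeff:
  fixes P :: "'a::comm_semiring_1 poly"
  assumes "degree P \<le> n"
  shows "poly P x = (\<Sum>j\<le>n. poly.coeff P j * x ^ j)"
  by (subst poly_as_sum_of_monoms'[OF assms, symmetric]) (simp add: poly_sum poly_monom)

definition lagrange_basis :: "('i \<Rightarrow> 'a::field) \<Rightarrow> 'i set \<Rightarrow> 'i \<Rightarrow> 'a poly" where
  "lagrange_basis x I i = (\<Prod>j\<in>I - {i}. smult (inverse (x i - x j)) [:- x j, 1:])"

lemma poly_lagrange_basis: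
  assumes "finite I" "inj_on x I" "i \<in> I" "j \<in> I"
  shows "poly (lagrange_basis x I i) (x j) = (if i = j then 1 else 0)"
proof (cases "i = j")
  case True
  have "poly (lagrange_basis x I i) (x i) = (\<Prod>j\<in>I - {i}. inverse (x i - x j) * (x i - x j))"
    by (simp add: lagrange_basis_def poly_prod algebra_simps)
  also have "\<dots> = 1"
    using assms by (intro prod.neutral ballI left_inverse) (auto dest: inj_onD)
  finally show ?thesis using True by simp
next
  case False
  then show ?thesis
    using assms by (auto simp: lagrange_basis_def poly_prod intro!: bexI[of _ j])
qed

lemma degree_lagrange_basis_less:
  assumes "finite I" "i \<in> I"
  shows "degree (lagrange_basis x I i) < card I"
proof -
  have "degree (lagrange_basis x I i) \<le> (\<Sum>j\<in>I - {i}. degree (smult (inverse (x i - x j)) [:- x j, 1:]))"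
    unfolding lagrange_basis_def
    using degree_prod_sum_le[of "I - {i}" "\<lambda>j. smult (inverse (x i - x j)) [:- x j, 1:]"] assms
    by (simp add: o_def)
  also have "\<dots> \<le> (\<Sum>j\<in>I - {i}. 1)"
    by (intro sum_mono) simp
  finally show ?thesis
    using assms card_Diff1_less[of I i] by simp
qed

abbreviation nat_lagrange_basis :: "nat \<Rightarrow> nat \<Rightarrow> 'a::field_char_0 poly" where
  "nat_lagrange_basis n \<equiv> lagrange_basis of_nat {..n}"

lemma degree_nat_lagrange_basis: "i \<le> n \<Longrightarrow> degree (nat_lagrange_basis n i) \<le> n"
  using degree_lagrange_basis_less[of "{..n}" i] by (simp add: less_Suc_eq_le)

lemma lagrange_interpolation:
  assumes I: "finite I" "inj_on x I" and P: "degree P < card I"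
  shows "(\<Sum>i\<in>I. smult (poly P (x i)) (lagrange_basis x I i)) = P"
proof (rule poly_eqI_degree[where A = "x ` I"])
  fix y assume "y \<in> x ` I"
  then obtain j where j: "j \<in> I" "y = x j" by blast
  have "poly (\<Sum>i\<in>I. smult (poly P (x i)) (lagrange_basis x I i)) y =
      (\<Sum>i\<in>I. if i = j then poly P (x i) else 0)"
    unfolding poly_sum using I j by (intro sum.cong) (simp_all add: poly_lagrange_basis)
  then show "poly (\<Sum>i\<in>I. smult (poly P (x i)) (lagrange_basis x I i)) y = poly P y"
    using I j by simp
next
  have "degree (smult (poly P (x i)) (lagrange_basis x I i)) < card I" if "i \<in> I" for i
    using degree_lagrange_basis_less[OF I(1) that, of x] degree_smult_le by (rule le_less_trans[rotated])
  then show "degree (\<Sum>i\<in>I. smult (poly P (x i)) (lagrange_basis x I i)) < card (x ` I)"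
    using I P by (simp add: card_image degree_sum_less)
  show "degree P < card (x ` I)"
    using I P by (simp add: card_image)
qed

lemma (in vector_space) lagrange_coeff:
  assumes I: "finite I" "inj_on x I" and n: "n < card I" and e: "e \<le> n"
  shows "(\<Sum>i\<in>I. scale (poly.coeff (lagrange_basis x I i) e) (\<Sum>j\<le>n. scale (x i ^ j) (c j))) = c e"
proof -
  have coeff: "(\<Sum>i\<in>I. poly.coeff (lagrange_basis x I i) e * x i ^ j) = (if e = j then 1 else 0)"
    if "j \<le> n" for j
  proof -
    have "(\<Sum>i\<in>I. smult (x i ^ j) (lagrange_basis x I i)) = monom 1 j"
      using lagrange_interpolation[OF I, of "monom 1 j"] n that by (simp add: poly_monom degree_monom_eq)
    then have "poly.coeff (\<Sum>i\<in>I. smult (x i ^ j) (lagrange_basis x I i)) e = (if e = j then 1 else 0)"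
      by simp
    then show ?thesis by (simp add: coeff_sum mult.commute)
  qed
  have "(\<Sum>i\<in>I. scale (poly.coeff (lagrange_basis x I i) e) (\<Sum>j\<le>n. scale (x i ^ j) (c j))) =
      (\<Sum>j\<le>n. scale (\<Sum>i\<in>I. poly.coeff (lagrange_basis x I i) e * x i ^ j) (c j))"
    unfolding scale_sum_right scale_sum_left scale_scale by (rule sum.swap)
  also have "\<dots> = (\<Sum>j\<le>n. if e = j then c j else 0)"
    by (intro sum.cong) (simp_all add: coeff)
  finally show ?thesis using e by simp
qed

lemma (in vector_space) sum_scale_power_by_degree:
  assumes "finite I" "d ` I \<subseteq> {..M}"
  shows "(\<Sum>j\<le>M. scale (x ^ j) (\<Sum>i | i \<in> I \<and> d i = j. v i)) = (\<Sum>i\<in>I. scale (x ^ d i) (v i))"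
proof -
  have "(\<Sum>j\<le>M. scale (x ^ j) (\<Sum>i | i \<in> I \<and> d i = j. v i)) =
      (\<Sum>j\<le>M. \<Sum>i | i \<in> I \<and> d i = j. scale (x ^ d i) (v i))"
    by (simp add: scale_sum_right)
  also have "\<dots> = (\<Sum>i\<in>I. scale (x ^ d i) (v i))"
    using assms by (intro sum.group) simp_all
  finally show ?thesis .
qed

locale vector_space_char_0 = vector_space scale
  for scale :: "'a::field_char_0 \<Rightarrow> 'b::ab_group_add \<Rightarrow> 'b" (infixr "\<cdot>" 75)
begin

definition polynomial_seq :: "nat \<Rightarrow> (nat \<Rightarrow> 'b) \<Rightarrow> bool" where
  "polynomial_seq n f \<longleftrightarrow> (\<exists>c. \<forall>m. f m = (\<Sum>j\<le>n. of_nat m ^ j \<cdot> c j))"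

lemma polynomial_coeffs_unique:
  assumes A: "finite A" "n < card A"
    and eq: "\<And>m. m \<in> A \<Longrightarrow> (\<Sum>j\<le>n. of_nat m ^ j \<cdot> c j) = (\<Sum>j\<le>n. of_nat m ^ j \<cdot> d j)"
    and e: "e \<le> n"
  shows "c e = d e"
proof -
  have inj: "inj_on (of_nat :: nat \<Rightarrow> 'a) A" by (simp add: inj_on_def)
  note recover = lagrange_coeff[OF A(1) inj A(2) e, symmetric]
  show ?thesis
    unfolding recover[of c] recover[of d] by (simp add: eq)
qed

lemma polynomial_seq_eqI:
  assumes "polynomial_seq n f" "polynomial_seq n g"
    and "finite A" "n < card A" "\<And>m. m \<in> A \<Longrightarrow> f m = g m"
  shows "f m = g m"
proof -
  obtain c d where f: "\<And>m. f m = (\<Sum>j\<le>n. of_nat m ^ j \<cdot> c j)"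
    and g: "\<And>m. g m = (\<Sum>j\<le>n. of_nat m ^ j \<cdot> d j)"
    using assms(1,2) unfolding polynomial_seq_def by blast
  have "c j = d j" if "j \<le> n" for j
    using assms(3-5) that unfolding f g by (rule polynomial_coeffs_unique)
  then show ?thesis by (simp add: f g)
qed

lemma polynomial_seq_sum_scale:
  assumes "\<And>i. i \<in> I \<Longrightarrow> polynomial_seq n (f i)"
  shows "polynomial_seq n (\<lambda>m. \<Sum>i\<in>I. a i \<cdot> f i m)"
proof -
  obtain c where c: "\<And>i m. i \<in> I \<Longrightarrow> f i m = (\<Sum>j\<le>n. of_nat m ^ j \<cdot> c i j)"
    using assms unfolding polynomial_seq_def by metis
  have "(\<Sum>i\<in>I. a i \<cdot> f i m) = (\<Sum>j\<le>n. of_nat m ^ j \<cdot> (\<Sum>i\<in>I. a i \<cdot> c i j))" for m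
  proof -
    have "(\<Sum>i\<in>I. a i \<cdot> f i m) = (\<Sum>i\<in>I. \<Sum>j\<le>n. of_nat m ^ j \<cdot> a i \<cdot> c i j)"
      by (simp add: c scale_sum_right mult.commute)
    also have "\<dots> = (\<Sum>j\<le>n. of_nat m ^ j \<cdot> (\<Sum>i\<in>I. a i \<cdot> c i j))"
      unfolding scale_sum_right by (rule sum.swap)
    finally show ?thesis .
  qed
  then show ?thesis unfolding polynomial_seq_def by (intro exI[of _ "\<lambda>j. \<Sum>i\<in>I. a i \<cdot> c i j"]) simp
qed

lemma polynomial_seq_poly:
  assumes "degree P \<le> n"
  shows "polynomial_seq n (\<lambda>m. poly P (of_nat m) \<cdot> v)"
proof -
  have "poly P (of_nat m) \<cdot> v = (\<Sum>j\<le>n. of_nat m ^ j \<cdot> poly.coeff P j \<cdot> v)" for m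
    by (simp add: poly_eq_sum_coeff[OF assms] scale_sum_left mult.commute)
  then show ?thesis unfolding polynomial_seq_def by (intro exI[of _ "\<lambda>j. poly.coeff P j \<cdot> v"]) simp
qed

lemma polynomial_seq_const: "polynomial_seq n (\<lambda>_. v)"
  using polynomial_seq_poly[of 1 n v] by simp

lemma polynomial_seq_graded_sum_truncate:
  assumes I: "finite I" and f: "polynomial_seq n (\<lambda>m. \<Sum>i\<in>I. of_nat m ^ d i \<cdot> v i)"
  shows "(\<Sum>i\<in>I. v i) = (\<Sum>i | i \<in> I \<and> d i \<le> n. v i)"
proof -
  obtain c where c: "\<And>m. (\<Sum>i\<in>I. of_nat m ^ d i \<cdot> v i) = (\<Sum>j\<le>n. of_nat m ^ j \<cdot> c j)"
    using f unfolding polynomial_seq_def by blast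
  define truncated where "truncated j = (if j \<le> n then c j else 0)" for j
  define part where "part j = (\<Sum>i | i \<in> I \<and> d i = j. v i)" for j
  define M where "M = Max (insert n (d ` I))"
  have M: "n \<le> M" "d ` I \<subseteq> {..M}" using I by (auto simp: M_def)
  have "(\<Sum>j\<le>M. of_nat m ^ j \<cdot> part j) = (\<Sum>j\<le>M. of_nat m ^ j \<cdot> truncated j)" for m
  proof -
    have "(\<Sum>j\<le>M. of_nat m ^ j \<cdot> part j) = (\<Sum>j\<le>n. of_nat m ^ j \<cdot> c j)"
      unfolding part_def sum_scale_power_by_degree[OF I M(2)] by (rule c)
    also have "\<dots> = (\<Sum>j\<le>M. of_nat m ^ j \<cdot> truncated j)"
      using M by (intro sum.mono_neutral_cong_left) (auto simp: truncated_def)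
    finally show ?thesis .
  qed
  then have part: "part j = truncated j" if "j \<le> M" for j
    using that by (intro polynomial_coeffs_unique[of "{..M}" M part truncated]) simp_all
  have "(\<Sum>i\<in>I. v i) = (\<Sum>j\<le>M. part j)"
    unfolding part_def using sum_scale_power_by_degree[OF I M(2), of 1 v] by simp
  also have "\<dots> = (\<Sum>j\<le>n. part j)"
    using M part by (intro sum.mono_neutral_right) (auto simp: truncated_def)
  also have "\<dots> = (\<Sum>j\<le>n. \<Sum>i | i \<in> {i \<in> I. d i \<le> n} \<and> d i = j. v i)"
    unfolding part_def by (intro sum.cong) auto
  also have "\<dots> = (\<Sum>i | i \<in> I \<and> d i \<le> n. v i)"
    using I by (intro sum.group) auto
  finally show ?thesis .
qed

definition polynomial_map :: "nat \<Rightarrow> ('s::ab_group_add \<Rightarrow> 'b) \<Rightarrow> bool" where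
  "polynomial_map n p \<longleftrightarrow> (\<forall>s t. polynomial_seq n (\<lambda>m. p (s + natmul m t)))"

lemma polynomial_map_sum_scale:
  assumes "\<And>i. i \<in> I \<Longrightarrow> polynomial_map n (p i)"
  shows "polynomial_map n (\<lambda>s. \<Sum>i\<in>I. a i \<cdot> p i s)"
  using assms unfolding polynomial_map_def by (intro allI polynomial_seq_sum_scale) blast

lemma polynomial_map_sum:
  assumes "\<And>i. i \<in> I \<Longrightarrow> polynomial_map n (p i)"
  shows "polynomial_map n (\<lambda>s. \<Sum>i\<in>I. p i s)"
  using polynomial_map_sum_scale[of I n p "\<lambda>_. 1"] assms by simp

lemma polynomial_map_compose_affine:
  assumes "polynomial_map n p" "Modules.additive \<theta>"
  shows "polynomial_map n (\<lambda>s. p (\<theta> s + a))"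
  unfolding polynomial_map_def
proof (intro allI)
  fix s t
  have "polynomial_seq n (\<lambda>m. p ((\<theta> s + a) + natmul m (\<theta> t)))"
    using assms(1) unfolding polynomial_map_def by blast
  then show "polynomial_seq n (\<lambda>m. p (\<theta> (s + natmul m t) + a))"
    by (simp add: additive.add[OF assms(2)] additive.natmul[OF assms(2)] ac_simps)
qed

lemma polynomial_map_prod_poly:
  assumes I: "finite I" and x: "\<And>i. i \<in> I \<Longrightarrow> Modules.additive (x i)"
    and P: "(\<Sum>i\<in>I. degree (P i)) \<le> n"
  shows "polynomial_map n (\<lambda>s. (\<Prod>i\<in>I. poly (P i) (x i s)) \<cdot> v)"
  unfolding polynomial_map_def
proof (intro allI)
  fix s t
  define Q where "Q i = pcompose (P i) [:x i s, x i t:]" for i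
  have "degree (Q i) \<le> degree (P i)" for i
    unfolding Q_def by (rule order.trans[OF degree_pcompose_le]) simp
  then have "(\<Sum>i\<in>I. degree (Q i)) \<le> n"
    using P by (meson order.trans sum_mono)
  then have "degree (\<Prod>i\<in>I. Q i) \<le> n"
    using degree_prod_sum_le[OF I, of Q] by (simp add: o_def)
  moreover have "poly (\<Prod>i\<in>I. Q i) (of_nat m) = (\<Prod>i\<in>I. poly (P i) (x i (s + natmul m t)))" for m
    unfolding poly_prod Q_def poly_pcompose
    by (intro prod.cong) (simp_all add: additive.add[OF x] additive.natmul[OF x] natmul_eq_of_nat_mult)
  ultimately show "polynomial_seq n (\<lambda>m. (\<Prod>i\<in>I. poly (P i) (x i (s + natmul m t))) \<cdot> v)"
    using polynomial_seq_poly[of "\<Prod>i\<in>I. Q i" n v] by simp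
qed

lemma polynomial_map_eq_on_multiples:
  assumes p: "polynomial_map n p" and q: "polynomial_map n q" and b: "b > 0"
    and eq: "\<And>i. i \<le> n \<Longrightarrow> p (natmul (b * i) u) = q (natmul (b * i) u)"
  shows "p (intmul a u) = q (intmul a u)"
proof -
  define M where "M = b * nat \<bar>a\<bar>"
  have shift: "- natmul M u + natmul (M + m) u = natmul m u" for m
    by (simp add: natmul_add)
  let ?v = "\<lambda>m. - natmul M u + natmul m u"
  have "p (?v m) = q (?v m)" for m
  proof (rule polynomial_seq_eqI)
    show "polynomial_seq n (\<lambda>m. p (?v m))" "polynomial_seq n (\<lambda>m. q (?v m))"
      using p q unfolding polynomial_map_def by blast+
    show "n < card ((\<lambda>i. M + b * i) ` {..n})"
      using b by (subst card_image) (auto simp: inj_on_def)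
    show "p (?v m) = q (?v m)" if "m \<in> (\<lambda>i. M + b * i) ` {..n}" for m
      using that eq by (auto simp only: shift)
  qed simp
  moreover have "?v (nat (int M + a)) = intmul a u"
  proof -
    have "\<bar>a\<bar> \<le> int b * \<bar>a\<bar>" using b by (simp add: mult_le_cancel_right1)
    then have "int (nat (int M + a)) = int M + a" by (simp add: M_def)
    then show ?thesis
      using intmul_of_nat[of "nat (int M + a)" u] intmul_add[of "int M" a u]
      by (simp add: intmul_of_nat algebra_simps)
  qed
  ultimately show ?thesis by metis
qed

lemma polynomial_map_interpolation:
  fixes p :: "'r::ring_1 \<Rightarrow> 'b" and x :: "'r \<Rightarrow> 'a"
  assumes p: "polynomial_map n p" and x: "Modules.additive x" "x 1 = 1"
    and u: "b > 0" "natmul b u = 1"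
  shows "p (intmul a u) = (\<Sum>i\<le>n. poly (nat_lagrange_basis n i) (x (intmul a u)) \<cdot> p (of_nat i))"
proof (rule polynomial_map_eq_on_multiples[OF p _ u(1)])
  let ?L = "nat_lagrange_basis n :: nat \<Rightarrow> 'a poly"
  show "polynomial_map n (\<lambda>s. \<Sum>i\<le>n. poly (?L i) (x s) \<cdot> p (of_nat i))"
  proof (rule polynomial_map_sum)
    fix i assume "i \<in> {..n}"
    then have "degree (?L i) \<le> n" by (simp add: degree_nat_lagrange_basis)
    then show "polynomial_map n (\<lambda>s. poly (?L i) (x s) \<cdot> p (of_nat i))"
      using polynomial_map_prod_poly[of "{()}" "\<lambda>_. x" "\<lambda>_. ?L i" n] x by simp
  qed
  fix i assume i: "i \<le> n"
  have node: "natmul (b * i) u = of_nat i"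
    using u(2) natmul_mult[of i b u] natmul_eq_of_nat_mult[of i "1 :: 'r"] by (simp add: mult.commute)
  have "x (of_nat i) = of_nat i"
    using additive.natmul[OF x(1), of i 1] by (simp add: x(2) natmul_eq_of_nat_mult)
  then have "(\<Sum>j\<le>n. poly (?L j) (x (of_nat i)) \<cdot> p (of_nat j)) =
      (\<Sum>j\<le>n. if j = i then p (of_nat j) else 0)"
    using i by (intro sum.cong) (simp_all add: poly_lagrange_basis inj_on_def)
  then show "p (natmul (b * i) u) = (\<Sum>j\<le>n. poly (?L j) (x (natmul (b * i) u)) \<cdot> p (of_nat j))"
    using i by (simp add: node)
qed

end

lemma (in vector_space) product_translation_expansion:
  fixes p :: "'g::ab_group_add \<Rightarrow> 'b"
  assumes "finite I"
    and "\<And>i. i \<in> I \<Longrightarrow> finite (A i)"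
    and "\<And>i t. i \<in> I \<Longrightarrow> p (t + \<sigma> i) = (\<Sum>a\<in>A i. scale (\<alpha> i a) (p (t + \<nu> i a)))"
  shows "p (t + (\<Sum>i\<in>I. \<sigma> i)) =
    (\<Sum>b\<in>PiE I A. scale (\<Prod>i\<in>I. \<alpha> i (b i)) (p (t + (\<Sum>i\<in>I. \<nu> i (b i)))))"
  using assms
proof (induction I arbitrary: t)
  case (insert i I)
  let ?term = "\<lambda>b. scale (\<Prod>j\<in>insert i I. \<alpha> j (b j)) (p (t + (\<Sum>j\<in>insert i I. \<nu> j (b j))))"
  have expand: "scale (\<Prod>j\<in>I. \<alpha> j (b j)) (p (t + \<sigma> i + (\<Sum>j\<in>I. \<nu> j (b j)))) =
      (\<Sum>a\<in>A i. ?term (b(i := a)))" for b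
  proof -
    have "p (t + \<sigma> i + (\<Sum>j\<in>I. \<nu> j (b j))) = p (t + (\<Sum>j\<in>I. \<nu> j (b j)) + \<sigma> i)"
      by (simp add: ac_simps)
    also have "\<dots> = (\<Sum>a\<in>A i. scale (\<alpha> i a) (p (t + (\<Sum>j\<in>I. \<nu> j (b j)) + \<nu> i a)))"
      by (rule insert.prems) simp
    finally have direction_i: "p (t + \<sigma> i + (\<Sum>j\<in>I. \<nu> j (b j))) = \<dots>" .
    have "(\<Prod>j\<in>insert i I. \<alpha> j ((b(i := a)) j)) = (\<Prod>j\<in>I. \<alpha> j (b j)) * \<alpha> i a" for a
      using insert.hyps by (simp add: mult.commute) (intro disjI2 prod.cong, auto)
    moreover have "(\<Sum>j\<in>insert i I. \<nu> j ((b(i := a)) j)) = (\<Sum>j\<in>I. \<nu> j (b j)) + \<nu> i a" for a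
      using insert.hyps by (simp add: add.commute) (intro sum.cong, auto)
    ultimately show ?thesis
      unfolding direction_i scale_sum_right by (simp add: add.assoc)
  qed
  have "p (t + (\<Sum>j\<in>insert i I. \<sigma> j)) = p (t + \<sigma> i + (\<Sum>j\<in>I. \<sigma> j))"
    using insert.hyps by (simp add: add.assoc)
  also have "\<dots> = (\<Sum>b\<in>PiE I A. scale (\<Prod>j\<in>I. \<alpha> j (b j)) (p (t + \<sigma> i + (\<Sum>j\<in>I. \<nu> j (b j)))))"
    using insert by simp
  also have "\<dots> = (\<Sum>a\<in>A i. \<Sum>b\<in>PiE I A. ?term (b(i := a)))"
    unfolding expand by (rule sum.swap)
  also have "\<dots> = (\<Sum>b\<in>PiE (insert i I) A. ?term b)"
    unfolding PiE_insert_eq sum.cartesian_product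
    by (subst sum.reindex[OF inj_combinator[OF insert.hyps(2)]]) (simp add: case_prod_beta)
  finally show ?case .
qed simp

section \<open>Polynomials with values in a topological vector space\<close>

locale complex_tvs = vector_space_char_0 sm
  for sm :: "complex \<Rightarrow> 'x::ab_group_add \<Rightarrow> 'x" (infixr "\<cdot>" 75) +
  fixes TX :: "'x topology"
  assumes top_X: "topspace TX = UNIV"
    and Hausdorff_X: "Hausdorff_space TX"
    and continuous_add: "continuous_map (prod_topology TX TX) TX (\<lambda>(x, y). x + y)"
    and continuous_scale: "continuous_map (prod_topology euclidean TX) TX (\<lambda>(a, x). a \<cdot> x)"
begin

lemma continuous_map_sum_scale:
  assumes "\<And>i. i \<in> I \<Longrightarrow> continuous_map T euclidean (f i)"
    and "\<And>i. i \<in> I \<Longrightarrow> continuous_map T TX (g i)"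
  shows "continuous_map T TX (\<lambda>x. \<Sum>i\<in>I. f i x \<cdot> g i x)"
  using assms
proof (induction I rule: infinite_finite_induct)
  case (insert i I)
  have "continuous_map T TX (\<lambda>x. f i x \<cdot> g i x)"
    using insert.prems
      continuous_map_compose[OF continuous_map_pairedI[of T euclidean "f i" TX "g i"] continuous_scale]
    by (simp add: o_def)
  then show ?case
    using insert
      continuous_map_compose[OF continuous_map_pairedI[of T TX "\<lambda>x. f i x \<cdot> g i x" TX] continuous_add]
    by (simp add: o_def)
qed (simp_all add: top_X)

lemma limitin_scale_compact:
  assumes C: "compactin TX C" "\<And>x. f x \<in> C" and a: "(a \<longlongrightarrow> 0) F"
  shows "limitin TX (\<lambda>x. a x \<cdot> f x) 0 F"
  unfolding limitin_def
proof (intro conjI allI impI)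
  fix V assume V: "openin TX V \<and> 0 \<in> V"
  define W where "W = {(b, x). b \<cdot> x \<in> V}"
  have "openin (prod_topology euclidean TX) W"
    using openin_continuous_map_preimage[OF continuous_scale] V
    by (simp add: W_def top_X case_prod_unfold)
  moreover have "compactin (euclidean :: complex topology) {0}" "{0} \<times> C \<subseteq> W"
    using V by (auto simp: W_def)
  ultimately obtain U Y where U: "open U" "0 \<in> U" and Y: "C \<subseteq> Y" "U \<times> Y \<subseteq> W"
    using Wallace_theorem_prod_topology[OF _ C(1)] by (metis insert_subset open_openin)
  have "\<forall>\<^sub>F x in F. a x \<in> U" using a U by (rule topological_tendstoD)
  then show "\<forall>\<^sub>F x in F. a x \<cdot> f x \<in> V"
    by (rule eventually_mono) (use C(2) Y in \<open>auto simp: W_def\<close>)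
qed (simp add: top_X)

lemma limitin_leading_coeff:
  "limitin TX (\<lambda>m. inverse (of_nat m) ^ n \<cdot> (\<Sum>j\<le>n. of_nat m ^ j \<cdot> c j)) (c n) sequentially"
proof -
  define reversed where "reversed \<epsilon> = (\<Sum>j\<le>n. \<epsilon> ^ (n - j) \<cdot> c j)" for \<epsilon> :: complex
  have "continuous_map euclidean TX reversed"
    unfolding reversed_def
    by (intro continuous_map_sum_scale) (auto simp: top_X intro!: continuous_intros)
  moreover have "limitin euclidean (\<lambda>m. inverse (of_nat m) :: complex) 0 sequentially"
    by (simp add: lim_inverse_n)
  ultimately have limit: "limitin TX (reversed \<circ> (\<lambda>m. inverse (of_nat m))) (reversed 0) sequentially"
    by (rule continuous_map_limit)
  have "reversed 0 = c n"
  proof -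
    have "reversed 0 = (\<Sum>j\<le>n. if j = n then c j else 0)"
      unfolding reversed_def by (intro sum.cong) auto
    then show ?thesis by simp
  qed
  moreover have "\<forall>\<^sub>F m in sequentially. (reversed \<circ> (\<lambda>m. inverse (of_nat m))) m =
      inverse (of_nat m) ^ n \<cdot> (\<Sum>j\<le>n. of_nat m ^ j \<cdot> c j)"
    using eventually_gt_at_top[of 0]
  proof eventually_elim
    case (elim m)
    have "inverse (of_nat m) ^ (n - j) = (inverse (of_nat m) ^ n * of_nat m ^ j :: complex)"
      if "j \<le> n" for j
      using that elim power_diff[of "inverse (of_nat m) :: complex" j n] by (simp add: field_simps)
    then show ?case by (simp add: reversed_def scale_sum_right)
  qed
  ultimately show ?thesis using limitin_transform_eventually[OF _ limit] by simp
qed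

text \<open>The leading coefficient is the limit of \<open>f m / m ^ n\<close>, and this limit is \<open>0\<close> when the values
  \<open>f m\<close> stay in a compact set.\<close>
lemma compact_valued_polynomial_seq_constant:
  assumes "polynomial_seq n f" and C: "compactin TX C" "\<And>m. f m \<in> C"
  shows "f m = f 0"
  using assms(1)
proof (induction n)
  case 0
  then show ?case by (auto simp: polynomial_seq_def)
next
  case (Suc n)
  then obtain c where c: "\<And>m. f m = (\<Sum>j\<le>Suc n. of_nat m ^ j \<cdot> c j)"
    unfolding polynomial_seq_def by blast
  have "(\<lambda>m. inverse (of_nat m) ^ Suc n :: complex) \<longlonglongrightarrow> 0 ^ Suc n"
    by (intro tendsto_power lim_inverse_n)
  then have "limitin TX (\<lambda>m. inverse (of_nat m) ^ Suc n \<cdot> f m) 0 sequentially"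
    using C by (intro limitin_scale_compact) simp_all
  then have "c (Suc n) = 0"
    using limitin_leading_coeff[of "Suc n" c] trivial_limit_sequentially
      limitin_Hausdorff_unique[OF _ _ _ Hausdorff_X]
    unfolding c by blast
  then have "polynomial_seq n f" unfolding polynomial_seq_def c by (intro exI[of _ c]) simp
  then show ?case by (rule Suc.IH)
qed

lemma poly_space_iff: "p \<in> poly_space TS TX sm n \<longleftrightarrow> continuous_map TS TX p \<and> polynomial_map n p"
  by (simp add: poly_space_def polynomial_map_def polynomial_seq_def)

lemma poly_space_sum_scale:
  assumes "\<And>i. i \<in> I \<Longrightarrow> f i \<in> poly_space TS TX sm n"
  shows "(\<lambda>t. \<Sum>i\<in>I. a i \<cdot> f i t) \<in> poly_space TS TX sm n"
  using assms unfolding poly_space_iff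
  by (intro conjI continuous_map_sum_scale polynomial_map_sum_scale) auto

lemma poly_space_compose_affine:
  assumes TG: "ab_top_group TG" and \<theta>: "continuous_map TS TG \<theta>" "Modules.additive \<theta>"
    and p: "p \<in> poly_space TG TX sm n"
  shows "(\<lambda>s. p (\<theta> s + a)) \<in> poly_space TS TX sm n"
proof -
  have "continuous_map TS (prod_topology TG TG) (\<lambda>s. (\<theta> s, a))"
    using TG \<theta>(1) by (intro continuous_map_pairedI) (simp_all add: ab_top_group_def)
  then have "continuous_map TS TG (\<lambda>s. \<theta> s + a)"
    using TG continuous_map_compose[of _ _ "\<lambda>s. (\<theta> s, a)" TG "\<lambda>(x, y). x + y"]
    by (simp add: ab_top_group_def o_def)
  then have "continuous_map TS TX (\<lambda>s. p (\<theta> s + a))"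
    using p continuous_map_compose[of TS TG _ TX p] by (simp add: poly_space_iff o_def)
  then show ?thesis
    using p polynomial_map_compose_affine[OF _ \<theta>(2)] by (simp add: poly_space_iff)
qed

lemma poly_space_translate:
  assumes "ab_top_group TG" "p \<in> poly_space TG TX sm n"
  shows "(\<lambda>t. p (t + a)) \<in> poly_space TG TX sm n"
  using assms by (intro poly_space_compose_affine) (auto simp: Modules.additive_def)

lemma poly_space_real_interpolation:
  fixes p :: "real \<Rightarrow> 'x"
  assumes p: "p \<in> poly_space euclidean TX sm n"
  shows "p s = (\<Sum>i\<le>n. poly (nat_lagrange_basis n i) (of_real s) \<cdot> p (of_nat i))" (is "_ = ?q s")
proof (rule forall_in_closure_of_eq[where f = p and g = ?q])
  show "s \<in> euclidean closure_of \<rat>"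
    using Rats_closure_real by (simp add: euclidean_closure_of)
  show "continuous_map euclidean TX p" using p by (simp add: poly_space_iff)
  show "continuous_map euclidean TX ?q"
    by (intro continuous_map_sum_scale)
      (auto simp: top_X continuous_on_def intro!: tendsto_poly tendsto_of_real tendsto_ident_at)
  fix s :: real assume "s \<in> \<rat>"
  then obtain a d where "d > 0" "s = of_int a / of_int d" by (elim Rats_cases')
  then obtain b where b: "b > 0" "s = of_int a / real b"
    using that[of "nat d"] by simp
  have "Modules.additive (of_real :: real \<Rightarrow> complex)" by unfold_locales simp
  then have "p (intmul a (1 / real b)) = ?q (intmul a (1 / real b))"
    using p b(1)
    by (intro polynomial_map_interpolation) (simp_all add: poly_space_iff natmul_eq_of_nat_mult)
  then show "p s = ?q s"
    by (simp add: b(2) intmul_eq_of_int_mult)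
qed (rule Hausdorff_X)

lemma poly_space_invariant_torsion_mod_compact:
  assumes TG: "ab_top_group TG" and p: "p \<in> poly_space TG TX sm n"
    and K: "compactin TG K" "\<And>i. natmul i (natmul N u) \<in> K" and N: "N > 0"
  shows "p (s + u) = p s"
proof -
  have seq: "polynomial_seq n (\<lambda>m. p (s + natmul m x))" for x
    using p by (simp add: poly_space_iff polynomial_map_def)
  have "compactin TX ((\<lambda>x. p (x + s)) ` K)"
    using poly_space_translate[OF TG p] by (intro image_compactin[OF K(1)]) (simp add: poly_space_iff)
  moreover have "p (s + natmul m (natmul N u)) \<in> (\<lambda>x. p (x + s)) ` K" for m
    using K(2) by (auto simp: add.commute)
  ultimately have const: "p (s + natmul m (natmul N u)) = p s" for m
    using compact_valued_polynomial_seq_constant[OF seq, of _ "natmul N u" m] by simp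
  have "p (s + natmul 1 u) = p s"
  proof (rule polynomial_seq_eqI[OF seq polynomial_seq_const])
    show "n < card ((\<lambda>i. i * N) ` {..n})"
      using N by (subst card_image) (auto simp: inj_on_def)
    show "p (s + natmul m u) = p s" if "m \<in> (\<lambda>i. i * N) ` {..n}" for m
      using that const by (auto simp: natmul_mult)
  qed simp
  then show ?thesis by simp
qed

end

lemma complex_tvs_of_locally_convex_tvs: "locally_convex_tvs TX sm \<Longrightarrow> complex_tvs sm TX"
  by unfold_locales (auto simp: locally_convex_tvs_def complex_vs_def)

lemma complex_tvs_complex: "complex_tvs ((*) :: complex \<Rightarrow> complex \<Rightarrow> complex) euclidean"
  by unfold_locales (auto simp: algebra_simps case_prod_unfold intro!: continuous_intros)

section \<open>Polynomials on a group with integer and real coordinates\<close>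

lemma sum_mult_over_image:
  fixes f :: "'i \<Rightarrow> 's \<Rightarrow> 'a::comm_ring"
  assumes "finite I"
  shows "(\<Sum>i\<in>I. f i x * a i) = (\<Sum>q\<in>f ` I. (\<Sum>i | i \<in> I \<and> f i = q. a i) * q x)"
proof -
  have "(\<Sum>i\<in>I. f i x * a i) = (\<Sum>q\<in>f ` I. \<Sum>i | i \<in> I \<and> f i = q. f i x * a i)"
    by (rule sum.image_gen[OF assms])
  also have "\<dots> = (\<Sum>q\<in>f ` I. (\<Sum>i | i \<in> I \<and> f i = q. a i) * q x)"
    unfolding sum_distrib_right by (intro sum.cong) (auto simp: mult.commute)
  finally show ?thesis .
qed

text \<open>Up to elements with a multiple in the compact set \<open>K\<close>, the group is spanned by the elements \<open>e i\<close>,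
  with integer coordinates \<open>z i\<close>, and by the real lines \<open>\<theta> i\<close>, with coordinates \<open>r i\<close>.\<close>
locale group_coordinates =
  fixes TG :: "'g::ab_group_add topology"
    and k m :: nat
    and z :: "nat \<Rightarrow> 'g \<Rightarrow> int" and e :: "nat \<Rightarrow> 'g"
    and r :: "nat \<Rightarrow> 'g \<Rightarrow> real" and \<theta> :: "nat \<Rightarrow> real \<Rightarrow> 'g"
    and K :: "'g set"
  assumes top_group: "ab_top_group TG"
    and additive_z: "\<And>i. i < k \<Longrightarrow> Modules.additive (z i)"
    and continuous_z: "\<And>i. i < k \<Longrightarrow> continuous_map TG euclidean (\<lambda>g. real_of_int (z i g))"
    and additive_r: "\<And>i. i < m \<Longrightarrow> Modules.additive (r i)"
    and continuous_r: "\<And>i. i < m \<Longrightarrow> continuous_map TG euclidean (r i)"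
    and additive_\<theta>: "\<And>i. i < m \<Longrightarrow> Modules.additive (\<theta> i)"
    and continuous_\<theta>: "\<And>i. i < m \<Longrightarrow> continuous_map euclidean TG (\<theta> i)"
    and compact_K: "compactin TG K"
    and natmul_K: "\<And>x i. x \<in> K \<Longrightarrow> natmul i x \<in> K"
    and residue: "\<And>g. \<exists>N>0.
      natmul N (g - ((\<Sum>i<k. intmul (z i g) (e i)) + (\<Sum>i<m. \<theta> i (r i g)))) \<in> K"
begin

text \<open>\<open>Inl\<close> indexes the integer coordinates and \<open>Inr\<close> the real ones.\<close>
abbreviation indices :: "(nat + nat) set" where
  "indices \<equiv> {..<k} <+> {..<m}"

definition coord :: "nat + nat \<Rightarrow> 'g \<Rightarrow> real" where
  "coord = case_sum (\<lambda>i g. real_of_int (z i g)) r"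

definition component :: "nat + nat \<Rightarrow> 'g \<Rightarrow> 'g" where
  "component = case_sum (\<lambda>i g. intmul (z i g) (e i)) (\<lambda>i g. \<theta> i (r i g))"

definition node :: "nat + nat \<Rightarrow> nat \<Rightarrow> 'g" where
  "node = case_sum (\<lambda>i a. natmul a (e i)) (\<lambda>i a. \<theta> i (real a))"

definition exponents :: "nat \<Rightarrow> (nat + nat \<Rightarrow> nat) set" where
  "exponents n = indices \<rightarrow>\<^sub>E {..n}"

definition coord_monomial :: "(nat + nat \<Rightarrow> nat) \<Rightarrow> 'g \<Rightarrow> complex" where
  "coord_monomial b h = (\<Prod>i\<in>indices. of_real (coord i h) ^ b i)"

definition total_degree :: "(nat + nat \<Rightarrow> nat) \<Rightarrow> nat" where
  "total_degree b = (\<Sum>i\<in>indices. b i)"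

definition low_exponents :: "nat \<Rightarrow> (nat + nat \<Rightarrow> nat) set" where
  "low_exponents n = {b \<in> exponents n. 0 < total_degree b \<and> total_degree b \<le> n}"

lemma finite_exponents: "finite (exponents n)"
  unfolding exponents_def by (intro finite_PiE) simp_all

lemma additive_coord: "i \<in> indices \<Longrightarrow> Modules.additive (coord i)"
  using additive_z additive_r by (auto simp: coord_def Modules.additive_def)

lemma continuous_map_coord: "i \<in> indices \<Longrightarrow> continuous_map TG euclidean (coord i)"
  using continuous_z continuous_r by (auto simp: coord_def)

lemma coord_monomial_natmul:
  "coord_monomial b (natmul j h) = of_nat j ^ total_degree b * coord_monomial b h"
proof -
  have "coord_monomial b (natmul j h) = (\<Prod>i\<in>indices. of_nat j ^ b i * of_real (coord i h) ^ b i)"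
    unfolding coord_monomial_def
    by (intro prod.cong)
      (simp_all add: additive.natmul[OF additive_coord] natmul_eq_of_nat_mult power_mult_distrib)
  then show ?thesis by (simp add: coord_monomial_def total_degree_def prod.distrib power_sum)
qed

lemma coord_monomial_0: "coord_monomial b 0 = (if total_degree b = 0 then 1 else 0)"
proof (cases "total_degree b = 0")
  case True
  then show ?thesis by (simp add: coord_monomial_def total_degree_def)
next
  case False
  then show ?thesis using coord_monomial_natmul[of b 0 0] by (simp add: power_0_left)
qed

lemma prod_poly_coord:
  assumes "\<And>i. i \<in> indices \<Longrightarrow> degree (P i) \<le> n"
  shows "(\<Prod>i\<in>indices. poly (P i) (of_real (coord i h))) =
    (\<Sum>b\<in>exponents n. coord_monomial b h * (\<Prod>i\<in>indices. poly.coeff (P i) (b i)))"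
proof -
  have "(\<Prod>i\<in>indices. poly (P i) (of_real (coord i h))) =
      (\<Prod>i\<in>indices. \<Sum>j\<le>n. poly.coeff (P i) j * of_real (coord i h) ^ j)"
    using assms by (intro prod.cong poly_eq_sum_coeff) simp_all
  also have "\<dots> = (\<Sum>b\<in>exponents n. \<Prod>i\<in>indices. poly.coeff (P i) (b i) * of_real (coord i h) ^ b i)"
    unfolding exponents_def by (intro prod_sum_PiE) simp_all
  finally show ?thesis by (simp add: coord_monomial_def prod.distrib mult.commute)
qed

lemma coord_monomial_in_poly_space:
  assumes "total_degree b \<le> n"
  shows "coord_monomial b \<in> scalar_poly_space TG n"
proof -
  interpret complex_tvs "(*) :: complex \<Rightarrow> complex \<Rightarrow> complex" euclidean by (rule complex_tvs_complex)
  have "continuous_map TG euclidean (coord_monomial b)"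
    unfolding coord_monomial_def[abs_def] continuous_map_atin limitin_canonical_iff
    using continuous_map_coord[unfolded continuous_map_atin limitin_canonical_iff]
    by (intro ballI tendsto_prod tendsto_power tendsto_of_real) blast
  moreover have "polynomial_map n (\<lambda>h. (\<Prod>i\<in>indices. poly (monom 1 (b i)) (of_real (coord i h))) * 1)"
    using assms additive_coord
    by (intro polynomial_map_prod_poly)
      (auto simp: degree_monom_eq Modules.additive_def total_degree_def)
  ultimately show ?thesis
    by (simp add: poly_space_iff coord_monomial_def[abs_def] poly_monom)
qed

end

locale tvs_group_coordinates = complex_tvs sm TX + group_coordinates TG k m z e r \<theta> K
  for sm :: "complex \<Rightarrow> 'x::ab_group_add \<Rightarrow> 'x" (infixr "\<cdot>" 75) and TX
    and TG :: "'g::ab_group_add topology" and k m z e r \<theta> K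
begin

lemma coord_interpolation:
  assumes p: "p \<in> poly_space TG TX sm n" and i: "i \<in> indices"
  shows "p (t + component i h) =
    (\<Sum>a\<le>n. poly (nat_lagrange_basis n a) (of_real (coord i h)) \<cdot> p (t + node i a))"
proof (cases i)
  case (Inl j)
  have "Modules.additive (\<lambda>a. intmul a (e j))" by unfold_locales (rule intmul_add)
  then have "polynomial_map n (\<lambda>a. p (intmul a (e j) + t))"
    using p by (intro polynomial_map_compose_affine) (simp_all add: poly_space_iff)
  then have "p (intmul (intmul (z j h) 1) (e j) + t) = (\<Sum>a\<le>n. poly (nat_lagrange_basis n a)
      (of_int (intmul (z j h) 1)) \<cdot> p (intmul (of_nat a) (e j) + t))"
    by (intro polynomial_map_interpolation[where b = 1]) (auto simp: Modules.additive_def)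
  then show ?thesis
    using Inl
    by (simp add: component_def coord_def node_def intmul_eq_of_int_mult intmul_of_nat add.commute)
next
  case (Inr j)
  then have "(\<lambda>s. p (\<theta> j s + t)) \<in> poly_space euclidean TX sm n"
    using i p continuous_\<theta> additive_\<theta> by (intro poly_space_compose_affine[OF top_group]) auto
  then show ?thesis
    using poly_space_real_interpolation[of "\<lambda>s. p (\<theta> j s + t)" n "r j h"] Inr
    by (simp add: component_def coord_def node_def add.commute)
qed

lemma poly_space_invariant_residue:
  assumes "p \<in> poly_space TG TX sm n"
  shows "p (t + h) = p (t + (\<Sum>i\<in>indices. component i h))"
proof -
  let ?c = "\<Sum>i\<in>indices. component i h"
  have "?c = (\<Sum>i<k. intmul (z i h) (e i)) + (\<Sum>i<m. \<theta> i (r i h))"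
    by (simp add: sum.Plus component_def o_def)
  then obtain N where "N > 0" "natmul N (h - ?c) \<in> K" using residue by metis
  then have "p (t + ?c + (h - ?c)) = p (t + ?c)"
    using assms natmul_K by (intro poly_space_invariant_torsion_mod_compact[OF top_group _ compact_K])
  then show ?thesis by simp
qed

definition monomial_coeff :: "nat \<Rightarrow> ('g \<Rightarrow> 'x) \<Rightarrow> (nat + nat \<Rightarrow> nat) \<Rightarrow> 'g \<Rightarrow> 'x" where
  "monomial_coeff n p b t = (\<Sum>a\<in>exponents n.
     (\<Prod>i\<in>indices. poly.coeff (nat_lagrange_basis n (a i)) (b i)) \<cdot>
     p (t + (\<Sum>i\<in>indices. node i (a i))))"

lemma monomial_coeff_in_poly_space:
  assumes "p \<in> poly_space TG TX sm n"
  shows "monomial_coeff n p b \<in> poly_space TG TX sm n"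
  unfolding monomial_coeff_def[abs_def]
  by (intro poly_space_sum_scale poly_space_translate[OF top_group assms])

lemma poly_translate_expansion:
  assumes p: "p \<in> poly_space TG TX sm n"
  shows "p (t + h) = (\<Sum>b\<in>exponents n. coord_monomial b h \<cdot> monomial_coeff n p b t)"
proof -
  let ?L = "nat_lagrange_basis n :: nat \<Rightarrow> complex poly"
  have "p (t + h) = (\<Sum>a\<in>exponents n. (\<Prod>i\<in>indices. poly (?L (a i)) (of_real (coord i h))) \<cdot>
      p (t + (\<Sum>i\<in>indices. node i (a i))))"
    unfolding exponents_def poly_space_invariant_residue[OF p, of t h]
    using coord_interpolation[OF p] by (intro product_translation_expansion) simp_all
  also have "\<dots> = (\<Sum>a\<in>exponents n. \<Sum>b\<in>exponents n. coord_monomial b h \<cdot>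
      (\<Prod>i\<in>indices. poly.coeff (?L (a i)) (b i)) \<cdot> p (t + (\<Sum>i\<in>indices. node i (a i))))"
  proof (intro sum.cong refl)
    fix a assume a: "a \<in> exponents n"
    have degree: "degree (?L (a i)) \<le> n" if "i \<in> indices" for i
      using a that unfolding exponents_def by (intro degree_nat_lagrange_basis) auto
    show "(\<Prod>i\<in>indices. poly (?L (a i)) (of_real (coord i h))) \<cdot>
          p (t + (\<Sum>i\<in>indices. node i (a i))) =
        (\<Sum>b\<in>exponents n. coord_monomial b h \<cdot>
          (\<Prod>i\<in>indices. poly.coeff (?L (a i)) (b i)) \<cdot> p (t + (\<Sum>i\<in>indices. node i (a i))))"
      by (simp add: prod_poly_coord[OF degree] scale_sum_left)
  qed
  also have "\<dots> = (\<Sum>b\<in>exponents n. coord_monomial b h \<cdot> monomial_coeff n p b t)"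
    unfolding monomial_coeff_def scale_sum_right by (rule sum.swap)
  finally show ?thesis .
qed

lemma poly_difference_expansion:
  assumes p: "p \<in> poly_space TG TX sm n"
  shows "p (t + h) - p t = (\<Sum>b\<in>low_exponents n. coord_monomial b h \<cdot> monomial_coeff n p b t)"
proof -
  define v where "v b = coord_monomial b h \<cdot> monomial_coeff n p b t" for b
  have graded: "p (t + natmul j h) = (\<Sum>b\<in>exponents n. of_nat j ^ total_degree b \<cdot> v b)" for j
    by (simp add: poly_translate_expansion[OF p] coord_monomial_natmul v_def)
  then have "polynomial_seq n (\<lambda>j. \<Sum>b\<in>exponents n. of_nat j ^ total_degree b \<cdot> v b)"
    using p by (simp add: poly_space_iff polynomial_map_def flip: graded)
  then have "(\<Sum>b\<in>exponents n. v b) = (\<Sum>b | b \<in> exponents n \<and> total_degree b \<le> n. v b)"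
    by (rule polynomial_seq_graded_sum_truncate[OF finite_exponents])
  moreover have "p (t + h) = (\<Sum>b\<in>exponents n. v b)" using graded[of 1] by simp
  moreover have "p t = (\<Sum>b | b \<in> exponents n \<and> total_degree b = 0. v b)"
  proof -
    have "p t = (\<Sum>b\<in>exponents n. if total_degree b = 0 then v b else 0)"
      using graded[of 0] by (simp add: power_0_left if_distrib[of "\<lambda>a. a \<cdot> _"] cong: if_cong)
    then show ?thesis by (simp add: sum.inter_filter finite_exponents)
  qed
  moreover have "(\<Sum>b | b \<in> exponents n \<and> total_degree b \<le> n. v b) =
      (\<Sum>b | b \<in> exponents n \<and> total_degree b = 0. v b) + (\<Sum>b\<in>low_exponents n. v b)"
    unfolding low_exponents_def
    using finite_exponents[of n] by (subst sum.union_disjoint[symmetric]) (auto intro!: sum.cong)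
  ultimately show ?thesis by (simp add: v_def)
qed

theorem poly_difference_separates:
  assumes p: "p \<in> poly_space TG TX sm n"
  shows "\<exists>(l::nat) ps qs. (\<forall>j<l. ps j \<in> poly_space TG TX sm n) \<and>
    (\<forall>j<l. qs j \<in> scalar_poly_space TG n \<and> qs j 0 = 0) \<and>
    (\<forall>h t. p (t + h) - p t = (\<Sum>j<l. qs j h \<cdot> ps j t))"
proof -
  have "finite (low_exponents n)" by (simp add: low_exponents_def finite_exponents)
  then obtain \<beta> where \<beta>: "bij_betw \<beta> {..<card (low_exponents n)} (low_exponents n)"
    using ex_bij_betw_nat_finite by (auto simp: atLeast0LessThan)
  show ?thesis
  proof (intro exI conjI allI impI)
    fix j assume "j < card (low_exponents n)"
    then have "\<beta> j \<in> low_exponents n" using \<beta> by (auto simp: bij_betw_def)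
    then show "coord_monomial (\<beta> j) \<in> scalar_poly_space TG n" "coord_monomial (\<beta> j) 0 = 0"
      by (simp_all add: low_exponents_def coord_monomial_in_poly_space coord_monomial_0)
  next
    show "p (t + h) - p t =
        (\<Sum>j<card (low_exponents n). coord_monomial (\<beta> j) h \<cdot> monomial_coeff n p (\<beta> j) t)" for h t
      unfolding poly_difference_expansion[OF p] by (rule sum.reindex_bij_betw[OF \<beta>, symmetric])
  qed (rule monomial_coeff_in_poly_space[OF p])
qed

end

theorem (in group_coordinates) scalar_poly_space_finite_dimensional:
  "\<exists>B. finite B \<and> (\<forall>p\<in>scalar_poly_space TG n. \<exists>c. \<forall>x. p x = (\<Sum>b\<in>B. c b * b x))"
proof (intro exI conjI ballI allI)
  show "finite (coord_monomial ` exponents n)" using finite_exponents by blast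
  fix p x assume p: "p \<in> scalar_poly_space TG n"
  interpret tvs_group_coordinates "(*) :: complex \<Rightarrow> complex \<Rightarrow> complex" euclidean TG k m z e r \<theta> K
    by (intro tvs_group_coordinates.intro complex_tvs_complex group_coordinates_axioms)
  have "p x = (\<Sum>b\<in>exponents n. coord_monomial b x * monomial_coeff n p b 0)"
    using poly_translate_expansion[OF p, of 0 x] by simp
  also note sum_mult_over_image[OF finite_exponents]
  finally show "p x = (\<Sum>q\<in>coord_monomial ` exponents n.
      (\<Sum>b | b \<in> exponents n \<and> coord_monomial b = q. monomial_coeff n p b 0) * q x)" .
qed

section \<open>Coordinates on a group with an open subgroup\<close>

locale subgroup_hom =
  fixes H :: "'g::ab_group_add set" and \<rho> :: "'g \<Rightarrow> 'v::real_vector"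
  assumes subgroup_H: "subgroup H add_grp"
    and hom_add: "\<And>x y. x \<in> H \<Longrightarrow> y \<in> H \<Longrightarrow> \<rho> (x + y) = \<rho> x + \<rho> y"
begin

lemma zero_mem: "0 \<in> H"
  using subgroup.one_closed[OF subgroup_H] by simp

lemma add_mem: "x \<in> H \<Longrightarrow> y \<in> H \<Longrightarrow> x + y \<in> H"
  using subgroup.m_closed[OF subgroup_H, of x y] by simp

lemma diff_mem: "x \<in> H \<Longrightarrow> y \<in> H \<Longrightarrow> x - y \<in> H"
  using add_mem[of x "- y"] subgroup.m_inv_closed[OF subgroup_H, of y] by simp

lemma sum_mem: "(\<And>i. i \<in> I \<Longrightarrow> f i \<in> H) \<Longrightarrow> sum f I \<in> H"
  by (induction I rule: infinite_finite_induct) (auto simp: zero_mem add_mem)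

lemma natmul_mem: "x \<in> H \<Longrightarrow> natmul j x \<in> H"
  by (simp add: natmul_def sum_mem)

lemma hom_zero: "\<rho> 0 = 0"
  using hom_add[OF zero_mem zero_mem] by simp

lemma hom_diff: "x \<in> H \<Longrightarrow> y \<in> H \<Longrightarrow> \<rho> (x - y) = \<rho> x - \<rho> y"
  using hom_add[of "x - y" y] diff_mem[of x y] by simp

lemma hom_sum: "(\<And>i. i \<in> I \<Longrightarrow> f i \<in> H) \<Longrightarrow> \<rho> (sum f I) = (\<Sum>i\<in>I. \<rho> (f i))"
  by (induction I rule: infinite_finite_induct) (auto simp: hom_zero hom_add sum_mem)

lemma hom_natmul: "x \<in> H \<Longrightarrow> \<rho> (natmul j x) = real j *\<^sub>R \<rho> x"
  by (simp add: natmul_def hom_sum sum_constant_scaleR)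

definition torsion_extension :: "'g \<Rightarrow> 'v" where
  "torsion_extension x = (let N = SOME N. N > 0 \<and> natmul N x \<in> H in \<rho> (natmul N x) /\<^sub>R real N)"

lemma torsion_extension_eq:
  assumes N: "N > 0" "natmul N x \<in> H"
  shows "torsion_extension x = \<rho> (natmul N x) /\<^sub>R real N"
proof -
  define M where "M = (SOME N. N > 0 \<and> natmul N x \<in> H)"
  have M: "M > 0" "natmul M x \<in> H"
    unfolding M_def using someI[of "\<lambda>N. N > 0 \<and> natmul N x \<in> H" N] N by simp_all
  have "real N *\<^sub>R \<rho> (natmul M x) = real M *\<^sub>R \<rho> (natmul N x)"
    using hom_natmul[OF M(2), of N] hom_natmul[OF N(2), of M]
    by (simp add: natmul_mult[symmetric] mult.commute)
  then have "\<rho> (natmul M x) = (real M / real N) *\<^sub>R \<rho> (natmul N x)"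
    using N(1) by (simp add: eq_vector_fraction_iff)
  then have "\<rho> (natmul M x) /\<^sub>R real M = \<rho> (natmul N x) /\<^sub>R real N"
    using M(1) by (simp add: divide_inverse)
  then show ?thesis by (simp add: torsion_extension_def M_def[symmetric])
qed

lemma torsion_extension_restrict: "x \<in> H \<Longrightarrow> torsion_extension x = \<rho> x"
  using torsion_extension_eq[of 1 x] by simp

lemma torsion_extension_add:
  assumes "\<exists>N>0. natmul N x \<in> H" "\<exists>N>0. natmul N y \<in> H"
  shows "torsion_extension (x + y) = torsion_extension x + torsion_extension y"
proof -
  obtain M N where MN: "M > 0" "natmul M x \<in> H" "N > 0" "natmul N y \<in> H" using assms by blast
  have xy: "natmul (M * N) x \<in> H" "natmul (M * N) y \<in> H"
    using MN natmul_mem[of "natmul M x" N] natmul_mem[of "natmul N y" M]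
    by (simp_all add: natmul_mult[symmetric] mult.commute)
  then have "natmul (M * N) (x + y) \<in> H" by (simp add: natmul_add_right add_mem)
  then show ?thesis
    using MN xy torsion_extension_eq[of "M * N"]
    by (simp add: natmul_add_right hom_add scaleR_add_right)
qed

end

lemma continuous_map_additive_open_subset:
  fixes f :: "'g::ab_group_add \<Rightarrow> 'v::real_normed_vector"
  assumes TG: "ab_top_group TG" and H: "openin TG H" "0 \<in> H"
    and f: "Modules.additive f" "continuous_map (subtopology TG H) euclidean f"
  shows "continuous_map TG euclidean f"
proof (rule pasting_lemma[where T = "\<lambda>a. {x \<in> topspace TG. x - a \<in> H}" and f = "\<lambda>_. f"])
  fix a
  have "continuous_map TG (prod_topology TG TG) (\<lambda>x. (x, - a))"
    using TG by (intro continuous_map_pairedI) (simp_all add: ab_top_group_def)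
  then have shift: "continuous_map TG TG (\<lambda>x. x - a)"
    using TG continuous_map_compose[of TG _ "\<lambda>x. (x, - a)" TG "\<lambda>(x, y). x + y"]
    by (simp add: ab_top_group_def o_def)
  show "openin TG {x \<in> topspace TG. x - a \<in> H}"
    using shift H(1) by (rule openin_continuous_map_preimage)
  have "continuous_map (subtopology TG {x \<in> topspace TG. x - a \<in> H}) (subtopology TG H) (\<lambda>x. x - a)"
    using shift by (auto simp: continuous_map_in_subtopology continuous_map_from_subtopology)
  from continuous_map_compose[OF this f(2)]
  have "continuous_map (subtopology TG {x \<in> topspace TG. x - a \<in> H}) euclidean (\<lambda>x. f (x - a) + f a)"
    by (intro continuous_map_add) (simp_all add: o_def)
  then show "continuous_map (subtopology TG {x \<in> topspace TG. x - a \<in> H}) euclidean f"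
    by (simp add: additive.diff[OF f(1)])
next
  fix x assume "x \<in> topspace TG"
  then show "\<exists>a. a \<in> UNIV \<and> x \<in> {x \<in> topspace TG. x - a \<in> H} \<and> f x = f x"
    using H(2) by (intro exI[of _ x]) simp
qed simp

lemma (in normal) epi_of_factor_group_iso:
  assumes L: "group L" and iso: "G Mod H \<cong> L"
  obtains \<Phi> where "\<Phi> \<in> epi G L" "kernel G L \<Phi> = H"
proof -
  obtain \<psi> where \<psi>: "\<psi> \<in> iso (G Mod H) L" using iso by (auto simp: is_iso_def)
  have coset: "(\<lambda>g. H #> g) \<in> epi G (G Mod H)"
    using r_coset_hom_Mod by (auto simp: epi_iff_subset FactGroup_def RCOSETS_def)
  have one: "\<psi> H = \<one>\<^bsub>L\<^esub>"
    using hom_one[OF _ factorgroup_is_group L, of \<psi>] \<psi> by (simp add: iso_def)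
  have H: "H \<in> carrier (G Mod H)"
    using monoid.one_closed[OF group.is_monoid[OF factorgroup_is_group]] by simp
  show ?thesis
  proof
    show "\<psi> \<circ> (\<lambda>g. H #> g) \<in> epi G L"
      using coset \<psi> by (auto intro: epi_compose simp: iso_iff_mon_epi)
    have "\<psi> (H #> g) = \<one>\<^bsub>L\<^esub> \<longleftrightarrow> g \<in> H" if g: "g \<in> carrier G" for g
    proof -
      have "\<psi> (H #> g) = \<psi> H \<longleftrightarrow> H #> g = H"
        using \<psi> coset H g by (intro inj_on_eq_iff) (auto simp: iso_def bij_betw_def epi_def hom_def)
      then show ?thesis
        using g coset_join1[OF _ g subgroup_axioms] coset_join2[OF g subgroup_axioms] one by auto
    qed
    then show "kernel G L (\<psi> \<circ> (\<lambda>g. H #> g)) = H"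
      using subset by (auto simp: kernel_def)
  qed
qed

locale integer_coordinates =
  fixes G0 :: "'g::ab_group_add set"
    and k :: nat and z :: "nat \<Rightarrow> 'g \<Rightarrow> int" and e :: "nat \<Rightarrow> 'g"
  assumes additive_z: "\<And>i. i < k \<Longrightarrow> Modules.additive (z i)"
    and z_G0: "\<And>i x. i < k \<Longrightarrow> x \<in> G0 \<Longrightarrow> z i x = 0"
    and z_e: "\<And>i j. i < k \<Longrightarrow> j < k \<Longrightarrow> z j (e i) = (if i = j then 1 else 0)"
    and torsion: "\<And>x. (\<And>i. i < k \<Longrightarrow> z i x = 0) \<Longrightarrow> \<exists>N>0. natmul N x \<in> G0"
begin

definition torsion_part :: "'g \<Rightarrow> 'g" where
  "torsion_part x = x - (\<Sum>i<k. intmul (z i x) (e i))"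

lemma torsion_part_add: "torsion_part (x + y) = torsion_part x + torsion_part y"
  by (simp add: torsion_part_def additive.add[OF additive_z] intmul_add sum.distrib)

lemma torsion_part_G0: "x \<in> G0 \<Longrightarrow> torsion_part x = x"
  by (simp add: torsion_part_def z_G0)

lemma torsion_part_torsion: "\<exists>N>0. natmul N (torsion_part x) \<in> G0"
proof (rule torsion)
  fix j assume j: "j < k"
  have "z j (\<Sum>i<k. intmul (z i x) (e i)) = (\<Sum>i<k. if i = j then z i x else 0)"
    unfolding additive.sum[OF additive_z[OF j]] additive.intmul[OF additive_z[OF j]]
    using j by (intro sum.cong) (simp_all add: intmul_eq_of_int_mult z_e)
  then show "z j (torsion_part x) = 0"
    using j by (simp add: torsion_part_def additive.diff[OF additive_z])
qed

end

lemma product_group_eq_one_iff: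
  "x \<in> carrier (product_group I G) \<Longrightarrow> x = \<one>\<^bsub>product_group I G\<^esub> \<longleftrightarrow> (\<forall>i\<in>I. x i = \<one>\<^bsub>G i\<^esub>)"
  by (auto simp: carrier_product_group fun_eq_iff PiE_def extensional_def)

lemma integer_coordinates_of_homs:
  fixes c :: "'g::ab_group_add \<Rightarrow> nat \<Rightarrow> int" and f :: "'g \<Rightarrow> 'f" and F :: "'f monoid"
  assumes F: "group F"
    and torsion: "\<And>x. x \<in> carrier F \<Longrightarrow> \<exists>N::nat. N > 0 \<and> x [^]\<^bsub>F\<^esub> N = \<one>\<^bsub>F\<^esub>"
    and c: "c \<in> hom add_grp (product_group {..<k} (\<lambda>_. integer_group))" and f: "f \<in> hom add_grp F"
    and G0: "\<And>g. g \<in> G0 \<longleftrightarrow> c g = \<one>\<^bsub>product_group {..<k} (\<lambda>_. integer_group)\<^esub> \<and> f g = \<one>\<^bsub>F\<^esub>"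
    and e: "\<And>i. i < k \<Longrightarrow> c (e i) = (\<lambda>j\<in>{..<k}. if i = j then 1 else 0)"
  shows "integer_coordinates G0 k (\<lambda>i g. c g i) e"
proof (rule integer_coordinates.intro)
  have carrier: "c g \<in> carrier (product_group {..<k} (\<lambda>_. integer_group))" "f g \<in> carrier F" for g
    using c f by (auto simp: hom_def)
  have G0_iff: "g \<in> G0 \<longleftrightarrow> (\<forall>i<k. c g i = 0) \<and> f g = \<one>\<^bsub>F\<^esub>" for g
    unfolding G0 product_group_eq_one_iff[OF carrier(1)] by auto
  show additive_c: "Modules.additive (\<lambda>g. c g i)" if "i < k" for i
    using c that by unfold_locales (simp add: hom_def product_group_def)
  show "c g i = 0" if "i < k" "g \<in> G0" for i g
    using that by (simp add: G0_iff)
  show "c (e i) j = (if i = j then 1 else 0)" if "i < k" "j < k" for i j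
    using that by (simp add: e)
  fix g assume g: "\<And>i. i < k \<Longrightarrow> c g i = 0"
  obtain N :: nat where N: "N > 0" "f g [^]\<^bsub>F\<^esub> N = \<one>\<^bsub>F\<^esub>" using torsion carrier(2) by blast
  then have "f (natmul N g) = \<one>\<^bsub>F\<^esub>"
    using hom_nat_pow[OF f, of g N] F by (simp add: group_add_grp nat_pow_add_grp)
  moreover have "c (natmul N g) i = 0" if "i < k" for i
    using g that by (simp add: additive.natmul[OF additive_c] natmul_eq_of_nat_mult)
  ultimately show "\<exists>N>0. natmul N g \<in> G0" using N(1) by (auto simp: G0_iff)
qed

lemma quotient_integer_coordinates:
  fixes G0 :: "'g::ab_group_add set" and F :: "'f monoid"
  assumes G0: "subgroup G0 add_grp" and F: "group F"
    and torsion: "\<And>x. x \<in> carrier F \<Longrightarrow> \<exists>N::nat. N > 0 \<and> x [^]\<^bsub>F\<^esub> N = \<one>\<^bsub>F\<^esub>"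
    and quot: "(add_grp Mod G0) \<cong> (product_group {..<k} (\<lambda>_. integer_group) \<times>\<times> F)"
  obtains z e where "integer_coordinates G0 k z e"
proof -
  let ?Z = "product_group {..<k} (\<lambda>_. integer_group)"
  have "group (?Z \<times>\<times> F)" by (intro DirProd_group product_group F) simp
  with comm_group.subgroup_imp_normal[OF comm_group_add_grp G0] obtain \<Phi>
    where \<Phi>: "\<Phi> \<in> epi add_grp (?Z \<times>\<times> F)" and kernel: "kernel add_grp (?Z \<times>\<times> F) \<Phi> = G0"
    using quot by (rule normal.epi_of_factor_group_iso)
  have homs: "fst \<circ> \<Phi> \<in> hom add_grp ?Z" "snd \<circ> \<Phi> \<in> hom add_grp F"
    using \<Phi> hom_pairwise[of \<Phi> add_grp ?Z F] by (simp_all add: epi_def)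
  have G0_iff: "g \<in> G0 \<longleftrightarrow> (fst \<circ> \<Phi>) g = \<one>\<^bsub>?Z\<^esub> \<and> (snd \<circ> \<Phi>) g = \<one>\<^bsub>F\<^esub>" for g
    by (simp add: kernel[symmetric] kernel_def one_DirProd prod_eq_iff)
  have "\<exists>g. (fst \<circ> \<Phi>) g = (\<lambda>j\<in>{..<k}. if i = j then 1 else 0)" for i
  proof -
    have "((\<lambda>j\<in>{..<k}. if i = j then 1 else 0), \<one>\<^bsub>F\<^esub>) \<in> \<Phi> ` carrier add_grp"
      using \<Phi> group.is_monoid[OF F, THEN monoid.one_closed]
      by (auto simp: epi_def carrier_product_group)
    then obtain g where "\<Phi> g = ((\<lambda>j\<in>{..<k}. if i = j then 1 else 0), \<one>\<^bsub>F\<^esub>)" by (metis imageE)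
    then show ?thesis by (intro exI[of _ g]) simp
  qed
  then obtain e where "\<And>i. (fst \<circ> \<Phi>) (e i) = (\<lambda>j\<in>{..<k}. if i = j then 1 else 0)" by metis
  from integer_coordinates_of_homs[OF F torsion homs G0_iff this] show ?thesis by (rule that)
qed

locale euclidean_compact_open_subgroup =
  fixes TG :: "'g::ab_group_add topology" and G0 :: "'g set" and m :: nat
    and TK :: "'k::ab_group_add topology" and \<phi> :: "'g \<Rightarrow> (nat \<Rightarrow> real) \<times> 'k"
  assumes top_group: "ab_top_group TG"
    and subgroup_G0: "subgroup G0 add_grp"
    and openin_G0: "openin TG G0"
    and top_group_K: "ab_top_group TK"
    and compact_space_K: "compact_space TK"
    and \<phi>_add: "\<And>x y. x \<in> G0 \<Longrightarrow> y \<in> G0 \<Longrightarrow>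
      \<phi> (x + y) = ((\<lambda>i. fst (\<phi> x) i + fst (\<phi> y) i), snd (\<phi> x) + snd (\<phi> y))"
    and homeomorphic_\<phi>:
      "homeomorphic_map (subtopology TG G0) (prod_topology (top_of_set (Rpow m)) TK) \<phi>"
begin

definition euclidean_coord :: "nat \<Rightarrow> 'g \<Rightarrow> real" where
  "euclidean_coord i x = fst (\<phi> x) i"

abbreviation axis_point :: "nat \<Rightarrow> real \<Rightarrow> nat \<Rightarrow> real" where
  "axis_point i s \<equiv> \<lambda>j. if j = i then s else 0"

definition line :: "nat \<Rightarrow> real \<Rightarrow> 'g" where
  "line i s = inv_into G0 \<phi> (axis_point i s, 0)"

definition compact_part :: "'g set" where
  "compact_part = {x \<in> G0. \<forall>i<m. euclidean_coord i x = 0}"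

sublocale euclidean: subgroup_hom G0 "euclidean_coord i" for i
  using subgroup_G0 by (intro subgroup_hom.intro) (simp_all add: euclidean_coord_def \<phi>_add)

lemma topspace_TG: "topspace TG = UNIV" and topspace_TK: "topspace TK = UNIV"
  using top_group top_group_K by (simp_all add: ab_top_group_def)

lemma \<phi>_image: "\<phi> ` G0 = Rpow m \<times> UNIV" and inj_on_\<phi>: "inj_on \<phi> G0"
  using homeomorphic_imp_surjective_map[OF homeomorphic_\<phi>]
    homeomorphic_imp_injective_map[OF homeomorphic_\<phi>]
  by (simp_all add: topspace_TG topspace_TK)

lemma \<phi>_inv_into: "v \<in> Rpow m \<Longrightarrow> \<phi> (inv_into G0 \<phi> (v, \<kappa>)) = (v, \<kappa>)"
  and inv_into_\<phi>_mem: "v \<in> Rpow m \<Longrightarrow> inv_into G0 \<phi> (v, \<kappa>) \<in> G0"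
  by (simp_all add: \<phi>_image f_inv_into_f inv_into_into)

lemma continuous_map_inv_into_\<phi>:
  "continuous_map (prod_topology (top_of_set (Rpow m)) TK) (subtopology TG G0) (inv_into G0 \<phi>)"
proof (subst open_eq_continuous_inverse_map[symmetric])
  show "open_map (subtopology TG G0) (prod_topology (top_of_set (Rpow m)) TK) \<phi>"
    by (rule homeomorphic_imp_open_map[OF homeomorphic_\<phi>])
qed (use \<phi>_image inj_on_\<phi> in \<open>auto simp: topspace_TG topspace_TK \<phi>_inv_into inv_into_\<phi>_mem\<close>)

lemma euclidean_coord_eq_0: "x \<in> G0 \<Longrightarrow> m \<le> i \<Longrightarrow> euclidean_coord i x = 0"
  using imageI[of x G0 \<phi>] unfolding \<phi>_image by (auto simp: euclidean_coord_def Rpow_def mem_Times_iff)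

lemma continuous_map_euclidean_coord: "continuous_map (subtopology TG G0) euclidean (euclidean_coord i)"
proof -
  have "continuous_map (subtopology TG G0) (top_of_set (Rpow m)) (fst \<circ> \<phi>)"
    using homeomorphic_imp_continuous_map[OF homeomorphic_\<phi>] continuous_map_fst
    by (rule continuous_map_compose)
  moreover have "continuous_map (top_of_set (Rpow m)) euclidean (\<lambda>v. v i)"
    using continuous_on_subset[OF continuous_on_product_coordinates subset_UNIV] by simp
  ultimately have "continuous_map (subtopology TG G0) euclidean ((\<lambda>v. v i) \<circ> (fst \<circ> \<phi>))"
    by (rule continuous_map_compose)
  then show ?thesis by (simp add: o_def euclidean_coord_def[abs_def])
qed

lemma axis_point_in_Rpow: "i < m \<Longrightarrow> axis_point i s \<in> Rpow m"
  by (auto simp: Rpow_def)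

lemma line_mem: "i < m \<Longrightarrow> line i s \<in> G0"
  by (simp add: line_def inv_into_\<phi>_mem axis_point_in_Rpow)

lemma \<phi>_line: "i < m \<Longrightarrow> \<phi> (line i s) = (axis_point i s, 0)"
  by (simp add: line_def \<phi>_inv_into axis_point_in_Rpow)

lemma euclidean_coord_line: "i < m \<Longrightarrow> euclidean_coord j (line i s) = (if j = i then s else 0)"
  by (simp add: euclidean_coord_def \<phi>_line)

lemma additive_line:
  assumes i: "i < m"
  shows "Modules.additive (line i)"
proof
  fix s t
  have "\<phi> (line i s + line i t) = \<phi> (line i (s + t))"
    using i by (auto simp: \<phi>_add line_mem \<phi>_line)
  then show "line i (s + t) = line i s + line i t"
    using inj_on_\<phi> i by (auto dest!: inj_onD intro: line_mem euclidean.add_mem)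
qed

lemma continuous_map_line:
  assumes i: "i < m"
  shows "continuous_map euclidean TG (line i)"
proof -
  have "continuous_on UNIV (axis_point i)"
  proof (intro continuous_on_coordinatewise_then_product)
    show "continuous_on UNIV (\<lambda>s. axis_point i s j)" for j by (cases "j = i") simp_all
  qed
  then have "continuous_map euclidean (prod_topology (top_of_set (Rpow m)) TK) (\<lambda>s. (axis_point i s, 0))"
    using axis_point_in_Rpow[OF i]
    by (intro continuous_map_pairedI) (auto simp: continuous_map_in_subtopology topspace_TK)
  from continuous_map_compose[OF this continuous_map_inv_into_\<phi>] show ?thesis
    by (simp add: o_def line_def[abs_def] continuous_map_in_subtopology)
qed

lemma compactin_compact_part: "compactin TG compact_part"
proof -
  have "compact_part = inv_into G0 \<phi> ` ({\<lambda>_. 0} \<times> UNIV)"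
  proof (intro equalityI subsetI)
    fix x assume "x \<in> compact_part"
    then have x: "x \<in> G0" "\<And>i. euclidean_coord i x = 0"
      using euclidean_coord_eq_0 by (auto simp: compact_part_def not_less[symmetric])
    then have "\<phi> x \<in> {\<lambda>_. 0} \<times> UNIV" by (auto simp: mem_Times_iff euclidean_coord_def)
    then show "x \<in> inv_into G0 \<phi> ` ({\<lambda>_. 0} \<times> UNIV)"
      using inv_into_f_f[OF inj_on_\<phi> x(1)] by (metis image_eqI)
  next
    have "(\<lambda>_. 0) \<in> Rpow m" by (simp add: Rpow_def)
    then show "x \<in> compact_part" if "x \<in> inv_into G0 \<phi> ` ({\<lambda>_. 0} \<times> UNIV)" for x
      using that by (auto simp: compact_part_def euclidean_coord_def \<phi>_inv_into inv_into_\<phi>_mem)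
  qed
  moreover have "compactin (prod_topology (top_of_set (Rpow m)) TK) ({\<lambda>_. 0} \<times> UNIV)"
    using compact_space_K by (auto simp: compactin_Times compact_space_def topspace_TK Rpow_def)
  ultimately have "compactin (subtopology TG G0) compact_part"
    using image_compactin[OF _ continuous_map_inv_into_\<phi>] by metis
  then show ?thesis by (simp add: compactin_subtopology)
qed

lemma natmul_compact_part: "x \<in> compact_part \<Longrightarrow> natmul j x \<in> compact_part"
  by (simp add: compact_part_def euclidean.natmul_mem euclidean.hom_natmul)

lemma continuous_map_additive_extension:
  fixes f :: "'g \<Rightarrow> real"
  assumes "Modules.additive f" "\<And>x. x \<in> G0 \<Longrightarrow> f x = g x"
    and "continuous_map (subtopology TG G0) euclidean g"
  shows "continuous_map TG euclidean f"
  using assms continuous_map_eq[of "subtopology TG G0" euclidean g f]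
  by (intro continuous_map_additive_open_subset[OF top_group openin_G0 euclidean.zero_mem]) simp_all

end

locale split_top_group =
  euclidean_compact_open_subgroup TG G0 m TK \<phi> + integer_coordinates G0 k z e
  for TG :: "'g::ab_group_add topology" and G0 m and TK :: "'k::ab_group_add topology" and \<phi> k z e
begin

definition real_coord :: "nat \<Rightarrow> 'g \<Rightarrow> real" where
  "real_coord i x = euclidean.torsion_extension i (torsion_part x)"

lemma additive_real_coord: "Modules.additive (real_coord i)"
  by unfold_locales
    (simp add: real_coord_def torsion_part_add euclidean.torsion_extension_add torsion_part_torsion)

lemma continuous_map_real_coord: "continuous_map TG euclidean (real_coord i)"
  using additive_real_coord _ continuous_map_euclidean_coord
  by (rule continuous_map_additive_extension)
    (simp add: real_coord_def torsion_part_G0 euclidean.torsion_extension_restrict)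

lemma continuous_map_z: "i < k \<Longrightarrow> continuous_map TG euclidean (\<lambda>x. real_of_int (z i x))"
  by (rule continuous_map_additive_extension[where g = "\<lambda>_. 0"])
    (simp_all add: z_G0 Modules.additive_def additive.add[OF additive_z])

lemma residue_in_compact_part:
  "\<exists>N>0. natmul N (x - ((\<Sum>i<k. intmul (z i x) (e i)) + (\<Sum>i<m. line i (real_coord i x)))) \<in> compact_part"
proof -
  define v where "v = (\<Sum>i<m. line i (real_coord i x))"
  obtain N where N: "N > 0" "natmul N (torsion_part x) \<in> G0" using torsion_part_torsion by blast
  have v: "v \<in> G0" unfolding v_def by (intro euclidean.sum_mem line_mem) simp
  have "euclidean_coord j v = real_coord j x" if "j < m" for j
  proof -
    have "euclidean_coord j v = (\<Sum>i<m. euclidean_coord j (line i (real_coord i x)))"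
      unfolding v_def by (intro euclidean.hom_sum line_mem) simp
    also have "\<dots> = (\<Sum>i<m. if i = j then real_coord i x else 0)"
      by (intro sum.cong) (simp_all add: euclidean_coord_line)
    finally show ?thesis using that by simp
  qed
  then have "euclidean_coord j (natmul N (torsion_part x) - natmul N v) = 0" if "j < m" for j
    using that N v by (simp add: euclidean.hom_diff euclidean.natmul_mem euclidean.hom_natmul
        real_coord_def euclidean.torsion_extension_eq[OF N])
  then have "natmul N (torsion_part x - v) \<in> compact_part"
    using N v by (simp add: compact_part_def natmul_diff_right euclidean.diff_mem euclidean.natmul_mem)
  then show ?thesis using N(1) by (auto simp: torsion_part_def v_def diff_diff_eq)
qed

sublocale group_coordinates TG k m z e real_coord line compact_part
  by (intro group_coordinates.intro)
    (simp_all add: top_group additive_z continuous_map_z additive_real_coord continuous_map_real_coord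
      additive_line continuous_map_line compactin_compact_part natmul_compact_part
      residue_in_compact_part)

end

theorem theorem3p4:
  fixes TG :: "'g::ab_group_add topology"
    and G0 :: "'g set"
    and m :: nat
    and TK :: "'k::ab_group_add topology"
    and \<phi> :: "'g \<Rightarrow> (nat \<Rightarrow> real) \<times> 'k"
    and k :: nat
    and F :: "'f monoid"
    and TX :: "'x::ab_group_add topology"
    and sm :: "complex \<Rightarrow> 'x \<Rightarrow> 'x"
  assumes G_top: "ab_top_group TG"
    and G_lc: "locally_compact_space TG"
    and G0_sub: "subgroup G0 add_grp"
    and G0_open: "openin TG G0"
    and K_top: "ab_top_group TK"
    and K_compact: "compact_space TK"
    and \<phi>_hom: "\<forall>x\<in>G0. \<forall>y\<in>G0. \<phi> (x + y) =
                  ((\<lambda>i. fst (\<phi> x) i + fst (\<phi> y) i), snd (\<phi> x) + snd (\<phi> y))"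
    and \<phi>_homeo: "homeomorphic_map (subtopology TG G0)
                   (prod_topology (subtopology euclidean (Rpow m)) TK) \<phi>"
    and F_group: "group F"
    and F_torsion: "\<forall>x\<in>carrier F. \<exists>N::nat. N > 0 \<and> x [^]\<^bsub>F\<^esub> N = \<one>\<^bsub>F\<^esub>"
    and quot: "(add_grp Mod G0) \<cong> (product_group {..<k} (\<lambda>_. integer_group) \<times>\<times> F)"
    and X_lctvs: "locally_convex_tvs TX sm"
  shows "(\<forall>n. \<exists>B. finite B \<and>
             (\<forall>p\<in>scalar_poly_space TG n. \<exists>c. \<forall>x. p x = (\<Sum>b\<in>B. c b * b x)))
       \<and> ((\<exists>N::nat. N > 0 \<and> (\<forall>x\<in>carrier F. x [^]\<^bsub>F\<^esub> N = \<one>\<^bsub>F\<^esub>)) \<longrightarrow>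
          (\<forall>n. \<forall>p\<in>poly_space TG TX sm n.
             \<exists>(l::nat) (ps::nat \<Rightarrow> 'g \<Rightarrow> 'x) (qs::nat \<Rightarrow> 'g \<Rightarrow> complex).
               (\<forall>j<l. ps j \<in> poly_space TG TX sm n) \<and>
               (\<forall>j<l. qs j \<in> scalar_poly_space TG n \<and> qs j 0 = 0) \<and>
               (\<forall>h t. p (t + h) - p t = (\<Sum>j<l. sm (qs j h) (ps j t)))))"
proof -
  interpret euclidean_compact_open_subgroup TG G0 m TK \<phi>
    using G_top G0_sub G0_open K_top K_compact \<phi>_hom \<phi>_homeo
    by (intro euclidean_compact_open_subgroup.intro) simp_all
  obtain z e where "integer_coordinates G0 k z e"
    using F_torsion by (auto intro: quotient_integer_coordinates[OF G0_sub F_group _ quot])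
  then interpret split_top_group TG G0 m TK \<phi> k z e
    by (intro split_top_group.intro euclidean_compact_open_subgroup_axioms)
  interpret tvs_group_coordinates sm TX TG k m z e real_coord line compact_part
    using X_lctvs
    by (intro tvs_group_coordinates.intro complex_tvs_of_locally_convex_tvs group_coordinates_axioms)
  show ?thesis
    using scalar_poly_space_finite_dimensional poly_difference_separates by blast
qed

end
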